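(* Let $w(x_1,x_2)=(1-x_1^2)^{-1/2}(1-x_2^2)^{-1/2}$ on $\mathcal{S}=[-1,1]\times[-1,1]$ (i.e. $\alpha_i=\beta_i=-\frac12$, $i=1,2$), and let $f:\mathcal{S}\to\mathbb{R}$ be such that $fw$ is integrable and the coefficients $\alpha_{i,j}$ of its orthogonal expansion converge to zero sufficiently rapidly (in the sense specified in the context). If, for $n_1$ and $n_2$ large enough, $$\max\left(|\tilde{\mathcal{E}}^{(1)}_{n_1,n_2}|,|\tilde{\mathcal{E}}^{(2)}_{n_1,n_2}|\right)<|\alpha_{2n_1,0}+\alpha_{0,2n_2}|,$$ where $$\begin{aligned} \tilde{\mathcal{E}}^{(1)}_{n_1,n_2}=&\ \sqrt2\,\alpha_{2n_1,2n_2}+\sum_{k_1=2}^\infty(-1)^{k_1}\left(\alpha_{2n_1k_1,0}-\sqrt2\,\alpha_{2n_1k_1,2n_2}\right)\\ &+\sqrt2\sum_{k_1=2}^\infty\sum_{k_2=2}^\infty(-1)^{k_1+k_2}\alpha_{2n_1k_1,2n_2k_2}+\sum_{k_2=2}^\infty(-1)^{k_2}\left(\alpha_{0,2n_2k_2}-\sqrt2\,\alpha_{2n_1,2n_2k_2}\right) \end{aligned}$$ and $$\begin{aligned} \tilde{\mathcal{E}}^{(2)}_{n_1,n_2}=&\ \sqrt2\,\alpha_{2n_1,2n_2}+\sum_{k_1=2}^\infty\left(\alpha_{2n_1k_1,0}+\sqrt2\,\alpha_{2n_1k_1,2n_2}\right)\\ &+\sqrt2\sum_{k_1=2}^\infty\sum_{k_2=2}^\infty\alpha_{2n_1k_1,2n_2k_2}+\sum_{k_2=2}^\infty\left(\alpha_{0,2n_2k_2}+\sqrt2\,\alpha_{2n_1,2n_2k_2}\right),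 \end{aligned}$$ then, for such $n_1,n_2$, either $$\mathcal{G}_{n_1,n_2}(f)\le\mathcal{I}(f)\le\mathcal{A}_{n_1+1,n_2+1}(f)\qquad\text{or}\qquad\mathcal{A}_{n_1+1,n_2+1}(f)\le\mathcal{I}(f)\le\mathcal{G}_{n_1,n_2}(f).$$
   Context: $\mathcal{I}(f)=\int_{\mathcal{S}}f(\mathbf{x})w(\mathbf{x})\,d\mathbf{x}$. Let $\pi_n$ ($n\ge0$) be the monic orthogonal polynomials with respect to the first-kind Chebyshev weight $(1-t^2)^{-1/2}$ on $[-1,1]$, with three-term recurrence $\pi_{j+1}(t)=(t-a_j)\pi_j(t)-b_j\pi_{j-1}(t)$, $\pi_{-1}=0$, $\pi_0=1$, $b_0=\int_{-1}^1(1-t^2)^{-1/2}dt=\pi$ (the number), and let $p_n$ be the corresponding orthonormal polynomials. The orthogonal expansion of $f$ is $f(\mathbf{x})=\sum_{i=0}^\infty\sum_{j=0}^\infty\alpha_{i,j}\,p_i(x_1)p_j(x_2)$ with $\alpha_{i,j}=\int_{\mathcal{S}}f(\mathbf{x})p_i(x_1)p_j(x_2)w(\mathbf{x})\,d\mathbf{x}$. For $n\ge1$, the $n$-point Gauss rule for $(1-t^2)^{-1/2}$ has as nodes the zeros of $\pi_n$ and as weights the Christoffel numbers. The $(n+1)$-point anti-Gauss rule has as nodes the zeros of $\pi_{n+1}-b_n\pi_{n-1}$, i.e. the eigenvalues of the symmetric tridiagonal matrix with diagonal $a_0,\dots,a_n$ and off-diagonal $\sqrt{b_1},\dots,\sqrt{b_{n-1}},\sqrt{2b_n}$,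 and its weights are $b_0$ times the squared first components of the normalized eigenvectors; all nodes lie in $[-1,1]$. $\mathcal{G}_{n_1,n_2}$ is the tensor product of the $n_1$-point Gauss rule in $x_1$ and the $n_2$-point Gauss rule in $x_2$; $\mathcal{A}_{n_1+1,n_2+1}$ is the tensor product of the $(n_1+1)$-point anti-Gauss rule in $x_1$ and the $(n_2+1)$-point anti-Gauss rule in $x_2$. "The coefficients converge to zero sufficiently rapidly" means: at every node of the rules $\mathcal{G}_{n_1,n_2}$ and $\mathcal{A}_{n_1+1,n_2+1}$ considered, the double series of the expansion converges absolutely and its sum is the value of $f$ there. *)

theory Defs
  imports "HOL-Analysis.Analysis" "Jordan_Normal_Form.Char_Poly"
begin

section \<open>Orthogonal polynomials for a weight on \<open>[-1, 1]\<close>\<close>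

definition weighted_inner :: "(real \<Rightarrow> real) \<Rightarrow> real poly \<Rightarrow> real poly \<Rightarrow> real" where
  "weighted_inner w p q = (LINT t:{-1..1}|lebesgue. poly p t * poly q t * w t)"

definition is_monic_op :: "(real \<Rightarrow> real) \<Rightarrow> nat \<Rightarrow> real poly \<Rightarrow> bool" where
  "is_monic_op w n p \<longleftrightarrow>
     degree p = n \<and> lead_coeff p = 1 \<and> (\<forall>q. degree q < n \<longrightarrow> weighted_inner w p q = 0)"

definition monic_op :: "(real \<Rightarrow> real) \<Rightarrow> nat \<Rightarrow> real poly" where
  "monic_op w n = (THE p. is_monic_op w n p)"

text \<open>The orthonormal polynomials are normalized to have positive leading coefficient.\<close>

definition orthonormal_op :: "(real \<Rightarrow> real) \<Rightarrow> nat \<Rightarrow> real poly" where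
  "orthonormal_op w n =
     Polynomial.smult (1 / sqrt (weighted_inner w (monic_op w n) (monic_op w n))) (monic_op w n)"

text \<open>
  The convention \<open>\<pi>\<^sub>-\<^sub>1 = 0\<close> is built into the case \<open>j = 0\<close>; there \<open>b 0\<close> does not
  enter the recurrence, so it is fixed separately to be the mass of the weight.
\<close>

definition three_term_recurrence :: "(real \<Rightarrow> real) \<Rightarrow> (nat \<Rightarrow> real) \<Rightarrow> (nat \<Rightarrow> real) \<Rightarrow> bool" where
  "three_term_recurrence w a b \<longleftrightarrow>
     (\<forall>j. monic_op w (Suc j) = [:- a j, 1:] * monic_op w j
            - (if j = 0 then 0 else Polynomial.smult (b j) (monic_op w (j - 1)))) \<and>
     b 0 = (LINT t:{-1..1}|lebesgue. w t)"

definition rec_a :: "(real \<Rightarrow> real) \<Rightarrow> nat \<Rightarrow> real" where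
  "rec_a w = (THE a. \<exists>b. three_term_recurrence w a b)"

definition rec_b :: "(real \<Rightarrow> real) \<Rightarrow> nat \<Rightarrow> real" where
  "rec_b w = (THE b. \<exists>a. three_term_recurrence w a b)"


section \<open>Gauss and anti-Gauss rules\<close>

definition gauss_nodes :: "(real \<Rightarrow> real) \<Rightarrow> nat \<Rightarrow> real set" where
  "gauss_nodes w n = {x. poly (monic_op w n) x = 0}"

text \<open>
  The Christoffel number of a Gauss node \<open>x\<close> is the weighted integral of the fundamental
  Lagrange polynomial at \<open>x\<close>.
\<close>

definition christoffel_number :: "(real \<Rightarrow> real) \<Rightarrow> nat \<Rightarrow> real \<Rightarrow> real" where
  "christoffel_number w n x =
     (LINT t:{-1..1}|lebesgue. (\<Prod>y\<in>gauss_nodes w n - {x}. (t - y) / (x - y)) * w t)"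

text \<open>
  For \<open>n \<ge> 1\<close>, the \<open>(n + 1)\<close>-point anti-Gauss rule; the argument is \<open>n\<close>, not the number of
  nodes.
\<close>

definition anti_gauss_nodes :: "(real \<Rightarrow> real) \<Rightarrow> nat \<Rightarrow> real set" where
  "anti_gauss_nodes w n =
     {x. poly (monic_op w (n + 1) - Polynomial.smult (rec_b w n) (monic_op w (n - 1))) x = 0}"

definition anti_gauss_offdiag :: "(real \<Rightarrow> real) \<Rightarrow> nat \<Rightarrow> nat \<Rightarrow> real" where
  "anti_gauss_offdiag w n k = (if k = n then sqrt (2 * rec_b w n) else sqrt (rec_b w k))"

text \<open>Rows and columns are numbered from 0, so the entry \<open>(k - 1, k)\<close> is the \<open>k\<close>-th off-diagonal one.\<close>

definition anti_gauss_matrix :: "(real \<Rightarrow> real) \<Rightarrow> nat \<Rightarrow> real Matrix.mat" where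
  "anti_gauss_matrix w n = Matrix.mat (n + 1) (n + 1) (\<lambda>(i, j).
     if i = j then rec_a w i
     else if j = i + 1 then anti_gauss_offdiag w n j
     else if i = j + 1 then anti_gauss_offdiag w n i
     else 0)"

text \<open>
  The eigenspaces are one-dimensional, so the squared first component of a normalized
  eigenvector depends on the eigenvalue \<open>x\<close> only.
\<close>

definition anti_gauss_weight :: "(real \<Rightarrow> real) \<Rightarrow> nat \<Rightarrow> real \<Rightarrow> real" where
  "anti_gauss_weight w n x = (THE c. \<exists>v. eigenvector (anti_gauss_matrix w n) v x \<and>
     scalar_prod v v = 1 \<and> c = rec_b w 0 * (vec_index v 0)\<^sup>2)"

definition gauss_cubature ::
    "(real \<Rightarrow> real) \<Rightarrow> nat \<Rightarrow> nat \<Rightarrow> (real \<times> real \<Rightarrow> real) \<Rightarrow> real" where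
  "gauss_cubature w n1 n2 f = (\<Sum>x\<in>gauss_nodes w n1. \<Sum>y\<in>gauss_nodes w n2.
     christoffel_number w n1 x * christoffel_number w n2 y * f (x, y))"

definition anti_gauss_cubature ::
    "(real \<Rightarrow> real) \<Rightarrow> nat \<Rightarrow> nat \<Rightarrow> (real \<times> real \<Rightarrow> real) \<Rightarrow> real" where
  "anti_gauss_cubature w n1 n2 f = (\<Sum>x\<in>anti_gauss_nodes w n1. \<Sum>y\<in>anti_gauss_nodes w n2.
     anti_gauss_weight w n1 x * anti_gauss_weight w n2 y * f (x, y))"


section \<open>The Chebyshev weight on the square\<close>

definition cheb_weight :: "real \<Rightarrow> real" where
  "cheb_weight t = (1 - t\<^sup>2) powr (- 1 / 2)"

definition square :: "(real \<times> real) set" where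
  "square = {-1..1} \<times> {-1..1}"

definition cheb_weight2 :: "real \<times> real \<Rightarrow> real" where
  "cheb_weight2 x = cheb_weight (fst x) * cheb_weight (snd x)"

definition cheb_integral :: "(real \<times> real \<Rightarrow> real) \<Rightarrow> real" where
  "cheb_integral f = (LINT x:square|lebesgue. f x * cheb_weight2 x)"

definition expansion_basis :: "nat \<Rightarrow> nat \<Rightarrow> real \<times> real \<Rightarrow> real" where
  "expansion_basis i j x =
     poly (orthonormal_op cheb_weight i) (fst x) * poly (orthonormal_op cheb_weight j) (snd x)"

definition expansion_coeff :: "(real \<times> real \<Rightarrow> real) \<Rightarrow> nat \<Rightarrow> nat \<Rightarrow> real" where
  "expansion_coeff f i j = (LINT x:square|lebesgue. f x * expansion_basis i j x * cheb_weight2 x)"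

definition expansion_converges_at :: "(real \<times> real \<Rightarrow> real) \<Rightarrow> real \<times> real \<Rightarrow> bool" where
  "expansion_converges_at f x \<longleftrightarrow>
     (\<lambda>(i, j). \<bar>expansion_coeff f i j * expansion_basis i j x\<bar>) summable_on UNIV \<and>
     ((\<lambda>(i, j). expansion_coeff f i j * expansion_basis i j x) has_sum f x) UNIV"

definition err1 :: "(real \<times> real \<Rightarrow> real) \<Rightarrow> nat \<Rightarrow> nat \<Rightarrow> real" where
  "err1 f n1 n2 = (let \<alpha> = expansion_coeff f in
     sqrt 2 * \<alpha> (2 * n1) (2 * n2)
     + (\<Sum>\<^sub>\<infinity>k1\<in>{2..}. (- 1) ^ k1 * (\<alpha> (2 * n1 * k1) 0 - sqrt 2 * \<alpha> (2 * n1 * k1) (2 * n2)))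
     + sqrt 2 * (\<Sum>\<^sub>\<infinity>k1\<in>{2..}. \<Sum>\<^sub>\<infinity>k2\<in>{2..}. (- 1) ^ (k1 + k2) * \<alpha> (2 * n1 * k1) (2 * n2 * k2))
     + (\<Sum>\<^sub>\<infinity>k2\<in>{2..}. (- 1) ^ k2 * (\<alpha> 0 (2 * n2 * k2) - sqrt 2 * \<alpha> (2 * n1) (2 * n2 * k2))))"

definition err2 :: "(real \<times> real \<Rightarrow> real) \<Rightarrow> nat \<Rightarrow> nat \<Rightarrow> real" where
  "err2 f n1 n2 = (let \<alpha> = expansion_coeff f in
     sqrt 2 * \<alpha> (2 * n1) (2 * n2)
     + (\<Sum>\<^sub>\<infinity>k1\<in>{2..}. \<alpha> (2 * n1 * k1) 0 + sqrt 2 * \<alpha> (2 * n1 * k1) (2 * n2))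
     + sqrt 2 * (\<Sum>\<^sub>\<infinity>k1\<in>{2..}. \<Sum>\<^sub>\<infinity>k2\<in>{2..}. \<alpha> (2 * n1 * k1) (2 * n2 * k2))
     + (\<Sum>\<^sub>\<infinity>k2\<in>{2..}. \<alpha> 0 (2 * n2 * k2) + sqrt 2 * \<alpha> (2 * n1) (2 * n2 * k2)))"

end

theory Submission
  imports Defs
begin

text \<open>
  Everything rests on the fact that the orthogonal polynomials of the weight are scaled Chebyshev
  polynomials, and that on Chebyshev polynomials both rules are explicit. With
  \<open>n\<close>-point Gauss nodes \<open>cos ((k + 1/2) \<pi> / n)\<close> and equal weights \<open>\<pi> / n\<close>, the rule sends \<open>T\<^sub>m\<close> to
  \<open>0\<close> unless \<open>m = 2 n k\<close>, when it gives \<open>(- 1)\<^sup>k \<pi>\<close>. The anti-Gauss rule has nodes \<open>cos (k \<pi> / n)\<close>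
  and trapezoidal weights (\<open>\<pi> / n\<close>, halved at both ends), and it sends \<open>T\<^sub>m\<close> to \<open>\<pi>\<close> if \<open>2 n\<close> divides
  \<open>m\<close> and to \<open>0\<close> otherwise. The two rules thus alias the same frequencies and differ only in a sign
  \<open>s = - 1\<close> or \<open>s = 1\<close> raised to the power \<open>k\<close> (lemmas \<open>gauss_rule_orthonormal\<close> and
  \<open>anti_gauss_rule_orthonormal\<close>).

  Since the expansion of \<open>f\<close> converges absolutely at the finitely many nodes, a product rule can be
  applied to it term by term. What remains is the double series of the coefficients
  \<open>\<alpha> (2 n\<^sub>1 k\<^sub>1) (2 n\<^sub>2 k\<^sub>2)\<close>, whose term \<open>(0, 0)\<close> is the integral of \<open>f\<close>. Splitting off the
  first two rows and columns gives (lemma \<open>rule_error\<close>)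
  \<open>rule - integral = \<surd>2 \<pi> (s (\<alpha> (2 n\<^sub>1) 0 + \<alpha> 0 (2 n\<^sub>2)) + E\<^sub>s)\<close>,
  where \<open>E\<^sub>s\<close> is the first error term for \<open>s = - 1\<close> and the second one for \<open>s = 1\<close>. If the
  error terms are smaller in absolute value than \<open>\<alpha> (2 n\<^sub>1) 0 + \<alpha> 0 (2 n\<^sub>2)\<close>, the latter determines
  the sign of both brackets, and the signs are opposite.
\<close>

section \<open>Chebyshev polynomials of the first kind\<close>

fun cheb_T :: "nat \<Rightarrow> real poly" where
  "cheb_T 0 = 1"
| "cheb_T (Suc 0) = [:0, 1:]"
| "cheb_T (Suc (Suc n)) = Polynomial.smult 2 ([:0, 1:] * cheb_T (Suc n)) - cheb_T n"

lemma poly_cheb_T_cos: "poly (cheb_T n) (cos \<theta>) = cos (real n * \<theta>)"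
proof (induction n rule: cheb_T.induct)
  case (3 n)
  have "cos (real (Suc (Suc n)) * \<theta>) + cos (real n * \<theta>) = 2 * cos \<theta> * cos (real (Suc n) * \<theta>)"
    by (simp add: cos_plus_cos algebra_simps add_divide_distrib)
  then show ?case
    using 3 by simp
qed auto

lemma poly_cheb_T: "t \<in> {-1..1} \<Longrightarrow> poly (cheb_T n) t = cos (real n * arccos t)"
  using poly_cheb_T_cos[of n "arccos t"] by simp

lemma degree_lead_coeff_cheb_T: "degree (cheb_T n) = n \<and> lead_coeff (cheb_T n) = 2 ^ (n - 1)"
proof (induction n rule: cheb_T.induct)
  case (3 n)
  let ?p = "Polynomial.smult 2 ([:0, 1:] * cheb_T (Suc n))"
  have deg: "degree (cheb_T (Suc n)) = Suc n" "degree (cheb_T n) = n"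
    and lead: "coeff (cheb_T (Suc n)) (Suc n) = 2 ^ n"
    using 3 by auto
  then have "cheb_T (Suc n) \<noteq> 0"
    by fastforce
  then have p: "degree ?p = Suc (Suc n)" "lead_coeff ?p = 2 ^ Suc n"
    using deg lead by (simp_all add: degree_mult_eq lead_coeff_mult)
  have "degree (- cheb_T n) < degree ?p"
    using deg p by simp
  then have "degree (?p + - cheb_T n) = degree ?p" "lead_coeff (?p + - cheb_T n) = lead_coeff ?p"
    by (rule degree_add_eq_left, metis add.commute lead_coeff_add_le)
  then show ?case
    using p by simp
qed auto

lemmas degree_cheb_T [simp] = degree_lead_coeff_cheb_T[THEN conjunct1]

lemma coeff_cheb_T_self: "coeff (cheb_T n) n = 2 ^ (n - 1)"
  using degree_lead_coeff_cheb_T[of n] by simp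

lemma cheb_T_nonzero: "cheb_T n \<noteq> 0"
proof
  assume "cheb_T n = 0"
  then have "coeff (cheb_T n) n = 0"
    by simp
  then show False
    unfolding coeff_cheb_T_self by simp
qed

text \<open>
  There is one Chebyshev polynomial of each degree, so subtracting a suitable multiple of one of
  them lowers the degree.
\<close>
lemma cheb_T_span:
  assumes "degree q < n"
  obtains c where "q = (\<Sum>k<n. Polynomial.smult (c k) (cheb_T k))"
proof -
  have "\<exists>c. q = (\<Sum>k<n. Polynomial.smult (c k) (cheb_T k))"
    using assms
  proof (induction n arbitrary: q)
    case (Suc n)
    define a where "a = coeff q n / 2 ^ (n - 1)"
    define r where "r = q - Polynomial.smult a (cheb_T n)"
    have coeff_r: "coeff r i = 0" if "i \<ge> n" for i
      using that Suc.prems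
      by (cases "i = n") (auto simp: r_def a_def coeff_cheb_T_self coeff_eq_0)
    have "\<exists>c. r = (\<Sum>k<n. Polynomial.smult (c k) (cheb_T k))"
    proof (cases "n = 0")
      case True
      then show ?thesis
        using coeff_r by (auto intro: poly_eqI)
    next
      case False
      then have "degree r < n"
        using coeff_r degree_lessI[of r n] by auto
      then show ?thesis
        by (rule Suc.IH)
    qed
    then obtain c where c: "r = (\<Sum>k<n. Polynomial.smult (c k) (cheb_T k))"
      by blast
    have "q = (\<Sum>k<Suc n. Polynomial.smult ((c(n := a)) k) (cheb_T k))"
      using c by (simp add: r_def algebra_simps)
    then show ?case
      by blast
  qed simp
  then show ?thesis
    using that by blast
qed

section \<open>Integration against the Chebyshev weight\<close>

lemma cheb_weight_nonneg: "cheb_weight t \<ge> 0"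
  by (simp add: cheb_weight_def)

lemma cheb_weight_eq: "-1 < t \<Longrightarrow> t < 1 \<Longrightarrow> cheb_weight t = 1 / sqrt (1 - t\<^sup>2)"
  by (simp add: cheb_weight_def powr_minus_divide powr_half_sqrt abs_square_less_1 less_imp_le)

text \<open>
  On the open interval, \<open>- sin (m arccos t) / m\<close> (for \<open>m = 0\<close>, \<open>- arccos t\<close>) is an antiderivative.
  It is continuous up to the end points, where the weight is singular, and that is enough for
  the fundamental theorem of calculus.
\<close>
lemma cheb_T_weight_has_integral:
  "((\<lambda>t. poly (cheb_T m) t * cheb_weight t) has_integral (if m = 0 then pi else 0)) {-1..1}"
proof -
  define F where "F = (\<lambda>t. if m = 0 then - arccos t else - sin (real m * arccos t) / real m)"
  have "((\<lambda>t. poly (cheb_T m) t * cheb_weight t) has_integral (F 1 - F (-1))) {-1..1}"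
  proof (rule fundamental_theorem_of_calculus_interior)
    show "continuous_on {-1..1} F"
      unfolding F_def by (cases "m = 0") (auto intro!: continuous_intros)
    fix t :: real assume t: "t \<in> {-1<..<1}"
    then have pos: "sqrt (1 - t\<^sup>2) > 0"
      by (simp add: abs_square_less_1 abs_less_iff)
    have "(F has_real_derivative poly (cheb_T m) t * cheb_weight t) (at t)"
    proof (cases "m = 0")
      case True
      then show ?thesis
        using t pos unfolding F_def
        by (auto intro!: derivative_eq_intros simp: cheb_weight_eq field_simps)
    next
      case False
      then show ?thesis
        using t pos unfolding F_def
        by (auto intro!: derivative_eq_intros simp: cheb_weight_eq poly_cheb_T field_simps)
    qed
    then show "(F has_vector_derivative poly (cheb_T m) t * cheb_weight t) (at t)"
      by (simp add: has_real_derivative_iff_has_vector_derivative)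
  qed simp
  moreover have "F 1 - F (-1) = (if m = 0 then pi else 0)"
    by (simp add: F_def)
  ultimately show ?thesis
    by simp
qed

lemma poly_weight_integrable:
  "set_integrable lebesgue {-1..1} (\<lambda>t. poly p t * cheb_weight t)"
proof (rule absolutely_integrable_bounded_measurable_product_real)
  show "poly p \<in> borel_measurable (lebesgue_on {-1..1})"
    by (intro continuous_imp_measurable_on_sets_lebesgue continuous_intros) auto
  show "bounded (poly p ` {-1..1})"
    by (intro compact_imp_bounded compact_continuous_image continuous_intros) auto
  have "cheb_weight integrable_on {-1..1}"
    using cheb_T_weight_has_integral[of 0] by (auto simp: integrable_on_def)
  then show "cheb_weight absolutely_integrable_on {-1..1}"
    by (intro nonnegative_absolutely_integrable_1) (simp_all add: cheb_weight_nonneg)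
qed auto

definition cheb_moment :: "real poly \<Rightarrow> real" where
  "cheb_moment p = (LINT t:{-1..1}|lebesgue. poly p t * cheb_weight t)"

lemma cheb_moment_add: "cheb_moment (p + q) = cheb_moment p + cheb_moment q"
  unfolding cheb_moment_def
  by (subst set_integral_add(2)[symmetric])
     (simp_all add: poly_weight_integrable distrib_right)

lemma cheb_moment_smult: "cheb_moment (Polynomial.smult c p) = c * cheb_moment p"
  unfolding cheb_moment_def by (simp add: mult.assoc)

lemma cheb_moment_sum: "cheb_moment (\<Sum>k\<in>A. p k) = (\<Sum>k\<in>A. cheb_moment (p k))"
proof (induction A rule: infinite_finite_induct)
  case (insert x F)
  then show ?case
    by (simp add: cheb_moment_add)
qed (simp_all add: cheb_moment_def)

lemma cheb_moment_cheb_T: "cheb_moment (cheb_T m) = (if m = 0 then pi else 0)"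
  using set_lebesgue_integral_eq_integral(2)[OF poly_weight_integrable[of "cheb_T m"]]
    integral_unique[OF cheb_T_weight_has_integral[of m]]
  by (simp add: cheb_moment_def)

lemma weighted_inner_cheb: "weighted_inner cheb_weight p q = cheb_moment (p * q)"
  by (simp add: weighted_inner_def cheb_moment_def)

text \<open>
  The product formula for cosines gives the identity on \<open>[-1, 1]\<close>, hence as polynomials.
\<close>
lemma cheb_T_mult:
  assumes "n \<le> m"
  shows "cheb_T m * cheb_T n = Polynomial.smult (1/2) (cheb_T (m + n) + cheb_T (m - n))"
    (is "?p = ?q")
proof (rule ccontr)
  assume "?p \<noteq> ?q"
  then have "finite {x. poly (?p - ?q) x = 0}"
    by (intro poly_roots_finite) simp
  moreover have "{-1..1} \<subseteq> {x. poly (?p - ?q) x = 0}"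
    using assms by (auto simp: poly_cheb_T cos_times_cos algebra_simps of_nat_diff)
  ultimately have "finite {-1..1 :: real}"
    by (rule finite_subset[rotated])
  then show False
    using infinite_Icc[of "-1::real" 1] by simp
qed

lemma cheb_moment_cheb_T_mult:
  "cheb_moment (cheb_T m * cheb_T n) = (if m = n then if n = 0 then pi else pi / 2 else 0)"
proof (induction n m rule: linorder_wlog)
  case (le n m)
  then show ?case
    by (simp add: cheb_T_mult cheb_moment_smult cheb_moment_add cheb_moment_cheb_T)
next
  case (sym m n)
  then show ?case
    by (metis mult.commute)
qed

section \<open>Orthogonal polynomials of the Chebyshev weight\<close>

lemma cheb_T_orthogonal:
  assumes "degree q < n"
  shows "cheb_moment (cheb_T n * q) = 0"
proof -
  obtain c where "q = (\<Sum>k<n. Polynomial.smult (c k) (cheb_T k))"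
    using cheb_T_span[OF assms] .
  then show ?thesis
    by (simp add: sum_distrib_left cheb_moment_sum cheb_moment_smult cheb_moment_cheb_T_mult)
qed

text \<open>
  The exponent \<open>n - 1\<close> is truncated, so the factor is \<open>1\<close> for \<open>n = 0\<close>, as it should be.
  For uniqueness, the difference \<open>d\<close> of two candidates has a degree \<open>m < n\<close> and is orthogonal to
  \<open>T\<^sub>m\<close>; but the inner product of \<open>d\<close> with \<open>T\<^sub>m\<close> is a nonzero multiple of its leading coefficient.
\<close>
lemma monic_op_cheb:
  "monic_op cheb_weight n = Polynomial.smult (1 / 2 ^ (n - 1)) (cheb_T n)" (is "_ = ?p")
proof -
  have p: "is_monic_op cheb_weight n ?p"
    unfolding is_monic_op_def weighted_inner_cheb
    by (simp add: cheb_moment_smult cheb_T_orthogonal coeff_cheb_T_self)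
  have "r = ?p" if r: "is_monic_op cheb_weight n r" for r
  proof (rule ccontr)
    define d where "d = r - ?p"
    define m where "m = degree d"
    assume "r \<noteq> ?p"
    then have "d \<noteq> 0"
      by (simp add: d_def)
    have "coeff d i = 0" if "i \<ge> n" for i
    proof -
      have "degree r = n" "coeff r n = 1"
        using r by (auto simp: is_monic_op_def)
      with that show ?thesis
        by (cases "i = n") (simp_all add: d_def coeff_cheb_T_self coeff_eq_0)
    qed
    then have "m < n"
      unfolding m_def using \<open>d \<noteq> 0\<close> by (meson leading_coeff_0_iff not_le)
    have "cheb_moment (r * cheb_T m) = 0" "cheb_moment (?p * cheb_T m) = 0"
      using r p \<open>m < n\<close> by (auto simp: is_monic_op_def weighted_inner_cheb)
    moreover have "r * cheb_T m = ?p * cheb_T m + d * cheb_T m"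
      by (simp add: d_def algebra_simps)
    ultimately have "cheb_moment (d * cheb_T m) = 0"
      by (simp add: cheb_moment_add)
    obtain c where c: "d = (\<Sum>k<Suc m. Polynomial.smult (c k) (cheb_T k))"
      using cheb_T_span[of d "Suc m"] by (auto simp: m_def)
    have "coeff d m = (\<Sum>k<Suc m. c k * coeff (cheb_T k) m)"
      by (subst c) (simp only: coeff_sum coeff_smult)
    also have "\<dots> = c m * 2 ^ (m - 1)"
      by (simp add: coeff_cheb_T_self coeff_eq_0)
    finally have "c m \<noteq> 0"
      using \<open>d \<noteq> 0\<close> by (auto simp: m_def)
    have "cheb_moment (d * cheb_T m)
        = (\<Sum>k<Suc m. c k * cheb_moment (cheb_T k * cheb_T m))"
      by (subst c) (simp only: sum_distrib_right cheb_moment_sum cheb_moment_smult mult_smult_left)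
    also have "\<dots> = c m * (if m = 0 then pi else pi / 2)"
      by (simp add: cheb_moment_cheb_T_mult)
    finally show False
      using \<open>cheb_moment (d * cheb_T m) = 0\<close> \<open>c m \<noteq> 0\<close> by (simp split: if_splits)
  qed
  with p show ?thesis
    unfolding monic_op_def by (rule the_equality)
qed

lemma orthonormal_op_cheb:
  "orthonormal_op cheb_weight n
     = Polynomial.smult (1 / sqrt (if n = 0 then pi else pi / 2)) (cheb_T n)"
  by (simp add: orthonormal_op_def weighted_inner_cheb monic_op_cheb cheb_moment_smult
      cheb_moment_cheb_T_mult real_sqrt_divide real_sqrt_mult)

text \<open>
  The coefficient with index \<open>1\<close> is \<open>1/2\<close> instead of \<open>1/4\<close> because \<open>T\<^sub>0\<close> has leading coefficient \<open>1\<close>,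
  twice what the formula \<open>2\<^sup>n\<^sup>-\<^sup>1\<close> for \<open>n \<ge> 1\<close> would give. Uniqueness follows by comparing the two
  highest coefficients of two recurrences.
\<close>
lemma three_term_recurrence_cheb:
  "three_term_recurrence cheb_weight a b
     \<longleftrightarrow> a = (\<lambda>_. 0) \<and> b = (\<lambda>j. if j = 0 then pi else if j = 1 then 1/2 else 1/4)"
proof -
  define P where "P = monic_op cheb_weight"
  define \<beta> :: "nat \<Rightarrow> real" where "\<beta> = (\<lambda>j. if j = 0 then pi else if j = 1 then 1/2 else 1/4)"
  have rec: "P (Suc j) = [:0, 1:] * P j
      - (if j = 0 then 0 else Polynomial.smult (\<beta> j) (P (j - 1)))" for j
  proof (cases j rule: cheb_T.cases)
    case (3 m)
    have "P (Suc j) = Polynomial.smult (1 / 2 ^ (m + 2))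
        (Polynomial.smult 2 ([:0, 1:] * cheb_T (Suc (Suc m))) - cheb_T (Suc m))"
      by (simp add: P_def monic_op_cheb 3)
    also have "\<dots> = Polynomial.smult (1 / 2 ^ (m + 1)) ([:0, 1:] * cheb_T (Suc (Suc m)))
        - Polynomial.smult (1 / 4 * (1 / 2 ^ m)) (cheb_T (Suc m))"
      by (simp add: smult_diff_right field_simps del: cheb_T.simps)
    also have "\<dots> = [:0, 1:] * P j - Polynomial.smult (\<beta> j) (P (j - 1))"
      by (simp add: P_def monic_op_cheb \<beta>_def 3 mult_smult_right del: cheb_T.simps)
    finally show ?thesis
      using 3 by simp
  qed (simp_all add: P_def monic_op_cheb \<beta>_def smult_diff_right one_pCons)
  have lead: "coeff (P j) j = 1" and deg: "degree (P j) = j" for j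
    by (simp_all add: P_def monic_op_cheb coeff_cheb_T_self)
  have mass: "(LINT t:{-1..1}|lebesgue. cheb_weight t) = pi"
    using cheb_moment_cheb_T[of 0] by (simp add: cheb_moment_def)
  show ?thesis
    unfolding \<beta>_def[symmetric]
  proof
    assume tt: "three_term_recurrence cheb_weight a b"
    then have rec': "P (Suc j) = [:- a j, 1:] * P j
        - (if j = 0 then 0 else Polynomial.smult (b j) (P (j - 1)))" for j
      unfolding three_term_recurrence_def P_def by blast
    have diff: "Polynomial.smult (a j) (P j)
        = (if j = 0 then 0 else Polynomial.smult (\<beta> j - b j) (P (j - 1)))" for j
    proof -
      have "[:- a j, 1:] * P j = [:0, 1:] * P j - Polynomial.smult (a j) (P j)"
        by (simp add: algebra_simps)
      then show ?thesis
        using rec[of j] rec'[of j] by (auto simp: smult_diff_left algebra_simps split: if_splits)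
    qed
    have a: "a j = 0" for j
      using arg_cong[OF diff[of j], of "\<lambda>p. coeff p j"] deg[of "j - 1"]
      by (simp add: lead coeff_eq_0 split: if_splits)
    have "b j = \<beta> j" for j
    proof (cases "j = 0")
      case True
      then show ?thesis
        using tt mass by (simp add: three_term_recurrence_def \<beta>_def)
    next
      case False
      then show ?thesis
        using arg_cong[OF diff[of j], of "\<lambda>p. coeff p (j - 1)"] by (simp add: lead a)
    qed
    with a show "a = (\<lambda>_. 0) \<and> b = \<beta>"
      by blast
  next
    assume "a = (\<lambda>_. 0) \<and> b = \<beta>"
    moreover have "\<beta> 0 = pi"
      by (simp add: \<beta>_def)
    ultimately show "three_term_recurrence cheb_weight a b"
      using rec mass unfolding three_term_recurrence_def P_def by simp
  qed
qed

lemma rec_a_cheb: "rec_a cheb_weight = (\<lambda>_. 0)"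
  by (simp add: rec_a_def three_term_recurrence_cheb)

lemma rec_b_cheb: "rec_b cheb_weight = (\<lambda>j. if j = 0 then pi else if j = 1 then 1/2 else 1/4)"
  by (simp add: rec_b_def three_term_recurrence_cheb)

section \<open>Cosine sums over equidistant angles\<close>

text \<open>
  A polynomial has no more roots than its degree, so a list of that many distinct roots is complete.
\<close>
lemma bij_betw_roots:
  fixes p :: "real poly"
  assumes "p \<noteq> 0" "finite A" "inj_on g A" "degree p \<le> card A"
    and root: "\<And>k. k \<in> A \<Longrightarrow> poly p (g k) = 0"
  shows "bij_betw g A {x. poly p x = 0}"
proof -
  have "card {x. poly p x = 0} \<le> card (g ` A)"
    using card_poly_roots_bound[OF \<open>p \<noteq> 0\<close>] assms by (simp add: card_image)
  moreover have "g ` A \<subseteq> {x. poly p x = 0}"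
    using root by auto
  ultimately have "g ` A = {x. poly p x = 0}"
    using poly_roots_finite[OF \<open>p \<noteq> 0\<close>] by (intro card_seteq) auto
  then show ?thesis
    using assms by (simp add: bij_betw_def)
qed

text \<open>
  With \<open>h = m \<pi> / n\<close>, the sum telescopes to \<open>sin (n h) = sin (m \<pi>) = 0\<close> after multiplication by
  \<open>2 sin (h / 2)\<close>. This factor vanishes precisely if \<open>2 n\<close> divides \<open>m\<close>, and then all terms are equal.
\<close>
lemma cos_midpoint_sum:
  assumes "n \<ge> 1"
  shows "(\<Sum>k<n. cos ((real k + 1 / 2) * (real m * pi / real n)))
    = (if 2 * n dvd m then real n * (- 1) ^ (m div (2 * n)) else 0)"
proof (cases "2 * n dvd m")
  case True
  then obtain j where m: "m = 2 * n * j"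
    by blast
  have "cos ((real k + 1 / 2) * (real m * pi / real n)) = (- 1) ^ j" for k
  proof -
    have "(real k + 1 / 2) * (real m * pi / real n) = real ((2 * k + 1) * j) * pi"
      using assms by (simp add: m field_simps)
    then show ?thesis
      by (simp only: cos_npi) (simp add: uminus_power_if)
  qed
  then show ?thesis
    using assms by (simp add: m)
next
  case False
  define h where "h = real m * pi / real n"
  have "sin (h / 2) \<noteq> 0"
  proof
    assume "sin (h / 2) = 0"
    then obtain i :: int where "h / 2 = of_int i * pi"
      by (auto simp: sin_zero_iff_int2)
    then have "real m = of_int i * (2 * real n)"
      using assms by (simp add: h_def field_simps)
    then have "real_of_int (int m) = real_of_int (i * int (2 * n))"
      by simp
    then have "int m = i * int (2 * n)"
      by (simp only: of_int_eq_iff)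
    then have "int (2 * n) dvd int m"
      by simp
    then have "2 * n dvd m"
      by (simp only: int_dvd_int_iff)
    with False show False ..
  qed
  moreover have "2 * sin (h / 2) * (\<Sum>k<n. cos ((real k + 1 / 2) * h)) = 0"
  proof -
    have "2 * sin (h / 2) * cos ((real k + 1 / 2) * h) = sin (real (Suc k) * h) - sin (real k * h)" for k
      by (simp add: sin_diff_sin field_simps)
    then have "2 * sin (h / 2) * (\<Sum>k<n. cos ((real k + 1 / 2) * h))
        = (\<Sum>k<n. sin (real (Suc k) * h) - sin (real k * h))"
      by (simp add: sum_distrib_left)
    also have "\<dots> = sin (real n * h)"
      by (subst sum_lessThan_telescope) simp
    also have "\<dots> = 0"
      using assms by (simp add: h_def)
    finally show ?thesis .
  qed
  ultimately show ?thesis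
    using False by (simp add: h_def)
qed

definition trapezoid_weight :: "nat \<Rightarrow> nat \<Rightarrow> real" where
  "trapezoid_weight n k = (if k = 0 \<or> k = n then 1 / 2 else 1)"

lemma trapezoid_sum_eq:
  assumes "n \<ge> 1"
  shows "(\<Sum>k\<le>n. trapezoid_weight n k * g k) = (\<Sum>k<n. (g k + g (Suc k)) / 2)"
proof -
  obtain l where n: "n = Suc l"
    using assms by (cases n) auto
  have "(\<Sum>k\<le>n. trapezoid_weight n k * g k) = g 0 / 2 + (\<Sum>k<l. g (Suc k)) + g n / 2"
    unfolding n by (subst sum.atMost_Suc, subst sum.atMost_shift)
      (simp add: trapezoid_weight_def)
  moreover have "(\<Sum>k<n. g k) = g 0 + (\<Sum>k<l. g (Suc k))"
    unfolding n by (rule sum.lessThan_Suc_shift)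
  moreover have "(\<Sum>k<n. g (Suc k)) = (\<Sum>k<l. g (Suc k)) + g n"
    unfolding n by simp
  ultimately show ?thesis
    by (simp add: sum.distrib flip: sum_divide_distrib)
qed

text \<open>
  The mean of \<open>cos (k h)\<close> and \<open>cos ((k + 1) h)\<close> is \<open>cos (h / 2) cos ((k + 1/2) h)\<close>, which reduces
  the trapezoidal sum to the midpoint sum.
\<close>
lemma cos_trapezoid_sum:
  assumes "n \<ge> 1"
  shows "(\<Sum>k\<le>n. trapezoid_weight n k * cos (real k * (real m * pi / real n)))
    = (if 2 * n dvd m then real n else 0)"
proof -
  define h where "h = real m * pi / real n"
  have "(cos (real k * h) + cos (real (Suc k) * h)) / 2 = cos (h / 2) * cos ((real k + 1 / 2) * h)" for k
    by (simp add: cos_plus_cos field_simps)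
  then have "(\<Sum>k\<le>n. trapezoid_weight n k * cos (real k * h))
      = cos (h / 2) * (\<Sum>k<n. cos ((real k + 1 / 2) * h))"
    by (simp add: trapezoid_sum_eq[OF assms] sum_distrib_left)
  also have "\<dots> = (if 2 * n dvd m then real n else 0)"
  proof (cases "2 * n dvd m")
    case True
    then obtain j where m: "m = 2 * n * j"
      by blast
    then have "h / 2 = real j * pi"
      using assms by (simp add: h_def)
    then have "cos (h / 2) = (- 1) ^ j"
      by (simp only: cos_npi)
    then show ?thesis
      using assms unfolding h_def
      by (subst cos_midpoint_sum) (simp_all add: m flip: power_add mult_2)
  next
    case False
    then have "(\<Sum>k<n. cos ((real k + 1 / 2) * h)) = 0"
      unfolding h_def by (subst cos_midpoint_sum[OF assms]) simp
    then show ?thesis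
      using False by simp
  qed
  finally show ?thesis
    by (simp add: h_def)
qed

section \<open>The Gauss rule\<close>

lemma gauss_nodes_cheb:
  assumes "n \<ge> 1"
  shows "bij_betw (\<lambda>k. cos ((real k + 1 / 2) * pi / real n)) {..<n} (gauss_nodes cheb_weight n)"
  unfolding gauss_nodes_def
proof (rule bij_betw_roots)
  show "monic_op cheb_weight n \<noteq> 0"
    by (simp add: monic_op_cheb cheb_T_nonzero)
  show "inj_on (\<lambda>k. cos ((real k + 1 / 2) * pi / real n)) {..<n}"
  proof (rule inj_onI)
    have range: "0 \<le> (real i + 1 / 2) * pi / real n \<and> (real i + 1 / 2) * pi / real n \<le> pi"
      if "i \<in> {..<n}" for i
      using that mult_right_mono[of "real i + 1 / 2" "real n" pi] assms
      by (simp add: divide_le_eq mult.commute)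
    fix j k assume "j \<in> {..<n}" "k \<in> {..<n}"
      and eq: "cos ((real j + 1 / 2) * pi / real n) = cos ((real k + 1 / 2) * pi / real n)"
    then have "(real j + 1 / 2) * pi / real n = (real k + 1 / 2) * pi / real n"
      using range eq by (metis cos_inj_pi)
    then show "j = k"
      using assms by (simp add: field_simps)
  qed
  fix k
  have "cos (real n * ((real k + 1 / 2) * pi / real n)) = cos (pi / 2 + real k * pi)"
    using assms by (intro arg_cong[where f = cos]) (simp add: field_simps)
  also have "\<dots> = 0"
    by (simp add: cos_add)
  finally show "poly (monic_op cheb_weight n) (cos ((real k + 1 / 2) * pi / real n)) = 0"
    by (simp add: monic_op_cheb poly_cheb_T_cos)
qed (simp_all add: monic_op_cheb)

lemma gauss_sum_cheb_T:
  assumes "n \<ge> 1"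
  shows "(\<Sum>x\<in>gauss_nodes cheb_weight n. poly (cheb_T m) x)
    = (if 2 * n dvd m then real n * (- 1) ^ (m div (2 * n)) else 0)"
proof -
  have "(\<Sum>x\<in>gauss_nodes cheb_weight n. poly (cheb_T m) x)
      = (\<Sum>k<n. cos ((real k + 1 / 2) * (real m * pi / real n)))"
    by (subst sum.reindex_bij_betw[OF gauss_nodes_cheb[OF assms], symmetric])
       (simp add: poly_cheb_T_cos mult_ac)
  then show ?thesis
    unfolding cos_midpoint_sum[OF assms] .
qed

lemma gauss_exact:
  assumes "degree q < n"
  shows "cheb_moment q = pi / real n * (\<Sum>x\<in>gauss_nodes cheb_weight n. poly q x)"
proof -
  obtain c where c: "q = (\<Sum>k<n. Polynomial.smult (c k) (cheb_T k))"
    using cheb_T_span[OF assms] .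
  have "(\<Sum>x\<in>gauss_nodes cheb_weight n. poly q x)
      = (\<Sum>k<n. c k * (\<Sum>x\<in>gauss_nodes cheb_weight n. poly (cheb_T k) x))"
    unfolding c by (simp add: poly_sum sum_distrib_left) (rule sum.swap)
  also have "\<dots> = (\<Sum>k<n. c k * (if k = 0 then real n else 0))"
    using assms by (intro sum.cong) (auto simp: gauss_sum_cheb_T dest: dvd_imp_le)
  finally have "pi / real n * (\<Sum>x\<in>gauss_nodes cheb_weight n. poly q x)
      = (\<Sum>k<n. c k * (if k = 0 then pi else 0))"
    using assms by (simp add: sum_distrib_left if_distrib cong: if_cong)
  then show ?thesis
    unfolding c by (simp add: cheb_moment_sum cheb_moment_smult cheb_moment_cheb_T)
qed

text \<open>
  The equal-weight rule is exact for the fundamental Lagrange polynomial at \<open>x\<close>, which has degree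
  \<open>n - 1\<close>, and only the node \<open>x\<close> contributes to it.
\<close>
lemma christoffel_number_cheb:
  assumes "n \<ge> 1" "x \<in> gauss_nodes cheb_weight n"
  shows "christoffel_number cheb_weight n x = pi / real n"
proof -
  let ?N = "gauss_nodes cheb_weight n"
  have N: "finite ?N" "card ?N = n"
    using bij_betw_finite[OF gauss_nodes_cheb] bij_betw_same_card[OF gauss_nodes_cheb] assms by auto
  define q where "q = (\<Prod>y\<in>?N - {x}. Polynomial.smult (1 / (x - y)) [:- y, 1:])"
  have q: "poly q t = (\<Prod>y\<in>?N - {x}. (t - y) / (x - y))" for t
    by (simp add: q_def poly_prod diff_divide_distrib)
  have "degree q \<le> (\<Sum>y\<in>?N - {x}. degree (Polynomial.smult (1 / (x - y)) [:- y, 1:]))"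
    unfolding q_def using degree_prod_sum_le[of "?N - {x}" "\<lambda>y. Polynomial.smult (1 / (x - y)) [:- y, 1:]"] N
    by (simp add: o_def)
  also have "\<dots> \<le> (\<Sum>y\<in>?N - {x}. 1)"
    by (intro sum_mono) (simp add: degree_pCons_eq_if)
  also have "\<dots> < n"
    using N assms by simp
  finally have "cheb_moment q = pi / real n * (\<Sum>y\<in>?N. poly q y)"
    by (rule gauss_exact)
  also have "(\<Sum>y\<in>?N. poly q y) = (\<Sum>y\<in>?N. if y = x then 1 else 0)"
  proof (rule sum.cong)
    fix y assume "y \<in> ?N"
    show "poly q y = (if y = x then 1 else 0)"
    proof (cases "y = x")
      case True
      then show ?thesis
        by (auto simp: q intro!: prod.neutral)
    next
      case False
      then show ?thesis
        using N \<open>y \<in> ?N\<close> by (auto simp: q intro!: prod_zero)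
    qed
  qed simp
  also have "\<dots> = 1"
    using N assms by simp
  finally show ?thesis
    by (simp add: christoffel_number_def cheb_moment_def q)
qed

text \<open>
  The value on the \<open>m\<close>-th orthonormal polynomial of the \<open>n\<close>-point Gauss rule, for \<open>s = - 1\<close>, and of
  the \<open>(n + 1)\<close>-point anti-Gauss rule, for \<open>s = 1\<close>.
\<close>
definition rule_value :: "real \<Rightarrow> nat \<Rightarrow> nat \<Rightarrow> real" where
  "rule_value s n m = (if 2 * n dvd m
     then if m = 0 then sqrt pi else sqrt (2 * pi) * s ^ (m div (2 * n)) else 0)"

lemma pi_div_sqrt: "pi / sqrt pi = sqrt pi" "pi / sqrt (pi / 2) = sqrt (2 * pi)"
proof -
  show "pi / sqrt pi = sqrt pi"
    by (simp add: real_div_sqrt)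
  have "sqrt (2 * pi) * sqrt (pi / 2) = sqrt (pi * pi)"
    by (simp only: real_sqrt_mult[symmetric]) simp
  then have "sqrt (2 * pi) * sqrt (pi / 2) = pi"
    by (simp only: real_sqrt_mult_self) simp
  moreover have "sqrt (pi / 2) \<noteq> 0"
    by simp
  ultimately show "pi / sqrt (pi / 2) = sqrt (2 * pi)"
    by (metis nonzero_mult_div_cancel_right)
qed

lemma rule_value_eq:
  assumes "n \<ge> 1"
  shows "pi / real n / sqrt (if m = 0 then pi else pi / 2)
      * (if 2 * n dvd m then real n * s ^ (m div (2 * n)) else 0) = rule_value s n m"
proof -
  have cancel: "pi / real n / r * (real n * z) = pi / r * z" for r z :: real
    using assms by simp
  show ?thesis
    unfolding rule_value_def
    by (cases "2 * n dvd m"; cases "m = 0") (simp_all only: cancel pi_div_sqrt if_True if_False, simp_all add: pi_div_sqrt)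
qed

lemma gauss_rule_orthonormal:
  assumes "n \<ge> 1"
  shows "(\<Sum>x\<in>gauss_nodes cheb_weight n.
      christoffel_number cheb_weight n x * poly (orthonormal_op cheb_weight m) x) = rule_value (- 1) n m"
proof -
  have "(\<Sum>x\<in>gauss_nodes cheb_weight n.
      christoffel_number cheb_weight n x * poly (orthonormal_op cheb_weight m) x)
    = pi / real n / sqrt (if m = 0 then pi else pi / 2)
      * (\<Sum>x\<in>gauss_nodes cheb_weight n. poly (cheb_T m) x)"
    using assms by (simp add: sum_distrib_left christoffel_number_cheb orthonormal_op_cheb)
  also have "\<dots> = rule_value (- 1) n m"
    unfolding gauss_sum_cheb_T[OF assms] by (rule rule_value_eq[OF assms])
  finally show ?thesis .
qed

section \<open>The anti-Gauss rule\<close>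

text \<open>
  The node polynomial is a multiple of \<open>T\<^sub>n\<^sub>+\<^sub>1 - T\<^sub>n\<^sub>-\<^sub>1\<close>, and
  \<open>cos ((n + 1) t) - cos ((n - 1) t) = - 2 sin (n t) sin t\<close>.
\<close>
lemma anti_gauss_nodes_cheb:
  assumes "n \<ge> 1"
  shows "bij_betw (\<lambda>k. cos (real k * pi / real n)) {..n} (anti_gauss_nodes cheb_weight n)"
  unfolding anti_gauss_nodes_def
proof (rule bij_betw_roots)
  let ?p = "monic_op cheb_weight (n + 1)
    - Polynomial.smult (rec_b cheb_weight n) (monic_op cheb_weight (n - 1))"
  have p: "?p = Polynomial.smult (1 / 2 ^ n) (cheb_T (n + 1) - cheb_T (n - 1))"
  proof (cases "n = 1")
    case False
    then obtain l where "n = Suc (Suc l)"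
      using assms by (metis One_nat_def Suc_le_D le_antisym not_less_eq_eq)
    then show ?thesis
      by (simp add: monic_op_cheb rec_b_cheb smult_diff_right del: cheb_T.simps)
  qed (simp add: monic_op_cheb rec_b_cheb smult_diff_right del: cheb_T.simps)
  have "coeff ?p (n + 1) = 1"
    unfolding p using coeff_cheb_T_self[of "n + 1"] by (simp add: coeff_eq_0 del: cheb_T.simps)
  then show "?p \<noteq> 0"
    by (metis coeff_0 zero_neq_one)
  have "degree (cheb_T (n + 1) - cheb_T (n - 1)) \<le> n + 1"
    by (intro degree_diff_le) (simp_all del: cheb_T.simps)
  then show "degree ?p \<le> card {..n}"
    unfolding p by (simp del: cheb_T.simps)
  show "inj_on (\<lambda>k. cos (real k * pi / real n)) {..n}"
  proof (rule inj_onI)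
    have range: "0 \<le> real i * pi / real n \<and> real i * pi / real n \<le> pi" if "i \<in> {..n}" for i
      using that mult_right_mono[of "real i" "real n" pi] assms
      by (simp add: divide_le_eq mult.commute)
    fix j k assume "j \<in> {..n}" "k \<in> {..n}"
      and eq: "cos (real j * pi / real n) = cos (real k * pi / real n)"
    then have "real j * pi / real n = real k * pi / real n"
      using range eq by (metis cos_inj_pi)
    then show "j = k"
      using assms by (simp add: field_simps)
  qed
  fix k
  let ?\<theta> = "real k * pi / real n"
  have diff: "cos (real (n + 1) * t) - cos (real (n - 1) * t) = - 2 * sin (real n * t) * sin t" for t
    using assms by (simp add: of_nat_diff distrib_right left_diff_distrib cos_add cos_diff)
  have "sin (real n * ?\<theta>) = 0"
    using assms by simp
  then show "poly ?p (cos ?\<theta>) = 0"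
    unfolding p poly_smult poly_diff poly_cheb_T_cos diff by simp
qed simp

text \<open>
  This factorization of the off-diagonal entries (\<open>1 / \<surd>2\<close> at both ends, \<open>1/2\<close> in between, and
  \<open>1\<close> for the only one if \<open>n = 1\<close>) exhibits the matrix as a diagonally rescaled form of
  the recurrence \<open>cos ((i + 1) \<theta>) + cos ((i - 1) \<theta>) = 2 cos \<theta> cos (i \<theta>)\<close>.
\<close>
lemma anti_gauss_offdiag_cheb:
  assumes "i < n"
  shows "anti_gauss_offdiag cheb_weight n (Suc i)
    = 1 / (sqrt (2 * trapezoid_weight n i) * sqrt (2 * trapezoid_weight n (Suc i)))"
  using assms
  by (auto simp: anti_gauss_offdiag_def rec_b_cheb trapezoid_weight_def real_sqrt_divide)

lemma anti_gauss_matrix_mult_vec: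
  assumes "v \<in> carrier_vec (n + 1)" "i \<le> n"
  shows "vec_index (mult_mat_vec (anti_gauss_matrix cheb_weight n) v) i
    = (if i < n then anti_gauss_offdiag cheb_weight n (Suc i) * vec_index v (Suc i) else 0)
      + (if i > 0 then anti_gauss_offdiag cheb_weight n i * vec_index v (i - 1) else 0)"
proof -
  let ?c = "anti_gauss_offdiag cheb_weight n"
  have "vec_index (mult_mat_vec (anti_gauss_matrix cheb_weight n) v) i
      = (\<Sum>j = 0..<n + 1. (if i = j then 0 else if j = i + 1 then ?c j
          else if i = j + 1 then ?c i else 0) * vec_index v j)"
    using assms by (simp add: anti_gauss_matrix_def mult_mat_vec_def scalar_prod_def rec_a_cheb
        cong: if_cong)
  also have "\<dots> = (\<Sum>j = 0..<n + 1. (if j = Suc i then ?c (Suc i) * vec_index v (Suc i) else 0)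
      + (if j = i - 1 then if i > 0 then ?c i * vec_index v (i - 1) else 0 else 0))"
    by (intro sum.cong) auto
  also have "\<dots> = (if i < n then ?c (Suc i) * vec_index v (Suc i) else 0)
      + (if i > 0 then ?c i * vec_index v (i - 1) else 0)"
    using assms by (simp only: sum.distrib sum.delta finite_atLeastLessThan) auto
  finally show ?thesis .
qed

text \<open>
  For a node \<open>cos \<theta>\<close>, this is the eigenvector
  \<open>(1, \<surd>2 cos \<theta>, \<dots>, \<surd>2 cos ((n - 1) \<theta>), cos (n \<theta>))\<close>, normalized by its first component.
\<close>
definition node_vector :: "nat \<Rightarrow> real \<Rightarrow> nat \<Rightarrow> real" where
  "node_vector n \<theta> i = sqrt (2 * trapezoid_weight n i) * cos (real i * \<theta>)"

lemma trapezoid_weight_pos: "trapezoid_weight n i > 0"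
  by (simp add: trapezoid_weight_def)

text \<open>
  In the first row a single neighbour remains, matched by the factor \<open>2\<close> that is missing on the right.
  In the last row, \<open>cos ((n - 1) \<theta>) = cos \<theta> cos (n \<theta>)\<close> requires that \<open>sin (n \<theta>) = 0\<close>.
\<close>
lemma anti_gauss_eigen_row:
  assumes "i \<le> n" "n \<ge> 1" "sin (real n * \<theta>) = 0"
  shows "(if i < n then anti_gauss_offdiag cheb_weight n (Suc i) * node_vector n \<theta> (Suc i) else 0)
      + (if i > 0 then anti_gauss_offdiag cheb_weight n i * node_vector n \<theta> (i - 1) else 0)
    = cos \<theta> * node_vector n \<theta> i"
proof -
  define s where "s j = sqrt (2 * trapezoid_weight n j)" for j
  have s: "s j > 0" "s j * s j = 2 * trapezoid_weight n j" for j
    using trapezoid_weight_pos[of n j] by (simp_all add: s_def)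
  have up: "anti_gauss_offdiag cheb_weight n (Suc i) * node_vector n \<theta> (Suc i)
      = cos (real (Suc i) * \<theta>) / s i" if "i < n"
    using s[of "Suc i"] that by (simp add: anti_gauss_offdiag_cheb node_vector_def flip: s_def)
  have down: "anti_gauss_offdiag cheb_weight n i * node_vector n \<theta> (i - 1)
      = cos (real (i - 1) * \<theta>) / s i" if "i > 0"
    using s[of "i - 1"] that \<open>i \<le> n\<close> anti_gauss_offdiag_cheb[of "i - 1" n]
    by (simp add: node_vector_def flip: s_def)
  have "(if i < n then cos (real (Suc i) * \<theta>) else 0) + (if i > 0 then cos (real (i - 1) * \<theta>) else 0)
      = cos \<theta> * (s i * s i * cos (real i * \<theta>))"
    using assms unfolding s
    by (auto simp: trapezoid_weight_def of_nat_diff distrib_right left_diff_distrib cos_add cos_diff)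
  then have "(if i < n then cos (real (Suc i) * \<theta>) / s i else 0)
      + (if i > 0 then cos (real (i - 1) * \<theta>) / s i else 0) = cos \<theta> * (s i * cos (real i * \<theta>))"
    using s[of i] by (auto simp: field_simps split: if_splits)
  moreover have "node_vector n \<theta> i = s i * cos (real i * \<theta>)"
    by (simp add: node_vector_def s_def)
  moreover have "(if i < n then anti_gauss_offdiag cheb_weight n (Suc i) * node_vector n \<theta> (Suc i) else 0)
      = (if i < n then cos (real (Suc i) * \<theta>) / s i else 0)"
    using up by (simp only: split: if_split) blast
  moreover have "(if i > 0 then anti_gauss_offdiag cheb_weight n i * node_vector n \<theta> (i - 1) else 0)
      = (if i > 0 then cos (real (i - 1) * \<theta>) / s i else 0)"
    using down by (simp only: split: if_split) blast
  ultimately show ?thesis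
    by (simp only:)
qed

text \<open>
  The off-diagonal entries are nonzero, so the rows of the eigenvalue equation determine the
  components of an eigenvector successively from the first one.
\<close>
lemma anti_gauss_eigenvector:
  assumes v: "eigenvector (anti_gauss_matrix cheb_weight n) v (cos \<theta>)"
    and n: "n \<ge> 1" "sin (real n * \<theta>) = 0" and "i \<le> n"
  shows "vec_index v i = vec_index v 0 * node_vector n \<theta> i"
  using \<open>i \<le> n\<close>
proof (induction i rule: less_induct)
  case (less i)
  show ?case
  proof (cases i)
    case 0
    then show ?thesis
      by (simp add: node_vector_def trapezoid_weight_def)
  next
    case (Suc l)
    let ?c = "anti_gauss_offdiag cheb_weight n"
    have dim: "v \<in> carrier_vec (n + 1)"
      and Av: "mult_mat_vec (anti_gauss_matrix cheb_weight n) v = smult_vec (cos \<theta>) v"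
      using v by (auto simp: eigenvector_def anti_gauss_matrix_def)
    have "?c i * vec_index v i
        + (if l > 0 then ?c l * vec_index v (l - 1) else 0) = cos \<theta> * vec_index v l"
      using anti_gauss_matrix_mult_vec[OF dim, of l] less.prems dim unfolding Av
      by (simp add: Suc)
    moreover have "vec_index v l = vec_index v 0 * node_vector n \<theta> l"
      using less.prems Suc by (intro less.IH) simp_all
    moreover have "vec_index v (l - 1) = vec_index v 0 * node_vector n \<theta> (l - 1)"
      using less.prems Suc by (intro less.IH) simp_all
    then have "(if l > 0 then ?c l * vec_index v (l - 1) else 0)
        = vec_index v 0 * (if l > 0 then ?c l * node_vector n \<theta> (l - 1) else 0)"
      by (simp only: mult.left_commute mult_zero_right split: if_split) simp
    moreover have "?c i * node_vector n \<theta> i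
        + (if l > 0 then ?c l * node_vector n \<theta> (l - 1) else 0) = cos \<theta> * node_vector n \<theta> l"
      using anti_gauss_eigen_row[of l n \<theta>] less.prems n Suc by simp
    \<comment> \<open>Subtracting \<open>vec_index v 0\<close> times row \<open>l\<close> for \<open>node_vector\<close> from row \<open>l\<close> for \<open>v\<close> leaves
      only the terms with index \<open>i = Suc l\<close>.\<close>
    moreover have "p = w * q" if "p + d = x * y" "y = w * z" "d = w * e" "q + e = x * z"
      for p q d e w x y z :: real
    proof -
      have "p = x * (w * z) - w * e" "q = x * z - e"
        using that by (simp_all add: eq_diff_eq)
      then show ?thesis
        by (simp add: right_diff_distrib)
    qed
    ultimately have "?c i * vec_index v i = vec_index v 0 * (?c i * node_vector n \<theta> i)"
      by blast
    moreover have "?c i \<noteq> 0"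
      using anti_gauss_offdiag_cheb[of l n] trapezoid_weight_pos[of n] less.prems Suc
      by (simp add: less_imp_neq[symmetric])
    ultimately show ?thesis
      by simp
  qed
qed

text \<open>
  By \<open>2 cos\<^sup>2 y = 1 + cos (2 y)\<close>, the squared norm is the sum of two trapezoidal cosine sums, of
  frequencies \<open>0\<close> and \<open>2 k\<close>; the second one vanishes except at the end points \<open>k = 0\<close> and \<open>k = n\<close>.
\<close>
lemma node_vector_norm:
  assumes "n \<ge> 1" "k \<le> n"
  shows "(\<Sum>i\<le>n. (node_vector n (real k * pi / real n) i)\<^sup>2) = real n / trapezoid_weight n k"
proof -
  \<comment> \<open>The constant term is written as a cosine of frequency \<open>0\<close>, so that one summation formula
    serves for both parts.\<close>
  have "(node_vector n (real k * pi / real n) i)\<^sup>2 = trapezoid_weight n i * cos (real i * (real 0 * pi / real n))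
      + trapezoid_weight n i * cos (real i * (real (2 * k) * pi / real n))" for i
  proof -
    define y where "y = real i * (real k * pi / real n)"
    have "real i * (real (2 * k) * pi / real n) = 2 * y"
      by (simp add: y_def)
    then have "cos (real i * (real (2 * k) * pi / real n)) = 2 * (cos y)\<^sup>2 - 1"
      by (simp only: cos_double_cos)
    moreover have "(node_vector n (real k * pi / real n) i)\<^sup>2 = 2 * trapezoid_weight n i * (cos y)\<^sup>2"
      using trapezoid_weight_pos[of n i]
      by (simp add: node_vector_def power_mult_distrib y_def)
    ultimately show ?thesis
      by (simp only:) (simp add: right_diff_distrib)
  qed
  then have "(\<Sum>i\<le>n. (node_vector n (real k * pi / real n) i)\<^sup>2)
      = real n + (if 2 * n dvd 2 * k then real n else 0)"
    by (simp only: sum.distrib cos_trapezoid_sum[OF assms(1)]) simp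
  also have "\<dots> = real n / trapezoid_weight n k"
    using assms by (auto simp: trapezoid_weight_def dest: dvd_imp_le)
  finally show ?thesis .
qed

text \<open>
  A unit eigenvector is a multiple of \<open>node_vector\<close>, whose first component is \<open>1\<close>. The
  squared first component of a unit eigenvector is therefore the inverse of the squared norm of
  \<open>node_vector\<close>.
\<close>
lemma anti_gauss_weight_cheb:
  assumes "n \<ge> 1" "k \<le> n"
  shows "anti_gauss_weight cheb_weight n (cos (real k * pi / real n))
    = pi / real n * trapezoid_weight n k"
proof -
  define \<theta> where "\<theta> = real k * pi / real n"
  define N where "N = (\<Sum>i\<le>n. (node_vector n \<theta> i)\<^sup>2)"
  have N: "N = real n / trapezoid_weight n k" "N > 0"
    using assms trapezoid_weight_pos[of n k] by (simp_all add: N_def \<theta>_def node_vector_norm)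
  have sin: "sin (real n * \<theta>) = 0"
    using assms by (simp add: \<theta>_def)
  let ?A = "anti_gauss_matrix cheb_weight n"
  have norm: "scalar_prod v v = (\<Sum>i\<le>n. (vec_index v i)\<^sup>2)" if "v \<in> carrier_vec (n + 1)" for v :: "real Matrix.vec"
    using that by (simp add: scalar_prod_def power2_eq_square atLeast0LessThan lessThan_Suc_atMost)
  have unique: "c = pi / N"
    if v: "eigenvector ?A v (cos \<theta>)" "scalar_prod v v = 1" "c = rec_b cheb_weight 0 * (vec_index v 0)\<^sup>2" for c v
  proof -
    have "v \<in> carrier_vec (n + 1)"
      using v by (simp add: eigenvector_def anti_gauss_matrix_def)
    then have "1 = (\<Sum>i\<le>n. (vec_index v i)\<^sup>2)"
      using v norm by simp
    also have "\<dots> = (\<Sum>i\<le>n. (vec_index v 0 * node_vector n \<theta> i)\<^sup>2)"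
    proof (rule sum.cong)
      fix i assume "i \<in> {..n}"
      then have "i \<le> n"
        by simp
      then have "vec_index v i = vec_index v 0 * node_vector n \<theta> i"
        by (rule anti_gauss_eigenvector[OF v(1) assms(1) sin])
      then show "(vec_index v i)\<^sup>2 = (vec_index v 0 * node_vector n \<theta> i)\<^sup>2"
        by (rule arg_cong)
    qed simp
    also have "\<dots> = (vec_index v 0)\<^sup>2 * N"
      by (simp add: N_def power_mult_distrib sum_distrib_left)
    finally have "(vec_index v 0)\<^sup>2 = 1 / N"
      using N(2) by (simp add: field_simps)
    then show ?thesis
      using v(3) by (simp add: rec_b_cheb)
  qed
  have exists: "\<exists>v. eigenvector ?A v (cos \<theta>) \<and> scalar_prod v v = 1 \<and> pi / N = rec_b cheb_weight 0 * (vec_index v 0)\<^sup>2"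
  proof (intro exI conjI)
    let ?v = "Matrix.vec (n + 1) (\<lambda>i. node_vector n \<theta> i / sqrt N)"
    have v: "?v \<in> carrier_vec (n + 1)"
      by simp
    have v0: "vec_index ?v 0 = 1 / sqrt N"
      by (simp add: node_vector_def trapezoid_weight_def)
    have "mult_mat_vec ?A ?v = smult_vec (cos \<theta>) ?v"
    proof (rule eq_vecI)
      fix i assume "i < dim_vec (smult_vec (cos \<theta>) ?v)"
      then have i: "i \<le> n"
        by simp
      show "vec_index (mult_mat_vec ?A ?v) i = vec_index (smult_vec (cos \<theta>) ?v) i"
        using i anti_gauss_eigen_row[OF i assms(1) sin] unfolding anti_gauss_matrix_mult_vec[OF v i]
        by (auto simp flip: add_divide_distrib split: if_splits)
    qed (simp add: anti_gauss_matrix_def)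
    moreover have "?v \<noteq> 0\<^sub>v (n + 1)"
    proof
      assume "?v = 0\<^sub>v (n + 1)"
      then have "vec_index ?v 0 = 0"
        by simp
      then show False
        unfolding v0 using N(2) by simp
    qed
    ultimately show "eigenvector ?A ?v (cos \<theta>)"
      using v by (simp add: eigenvector_def anti_gauss_matrix_def)
    have "scalar_prod ?v ?v = (\<Sum>i\<le>n. (node_vector n \<theta> i)\<^sup>2 / N)"
      unfolding norm[OF v] using N by (intro sum.cong) (simp_all add: power_divide)
    then show "scalar_prod ?v ?v = 1"
      using N(2) by (simp add: N_def flip: sum_divide_distrib)
    show "pi / N = rec_b cheb_weight 0 * (vec_index ?v 0)\<^sup>2"
      unfolding v0 using N by (simp add: rec_b_cheb power_divide)
  qed
  have "anti_gauss_weight cheb_weight n (cos \<theta>) = pi / N"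
    unfolding anti_gauss_weight_def using exists unique by (intro the_equality) blast+
  then show ?thesis
    using N by (simp add: \<theta>_def)
qed

lemma anti_gauss_rule_orthonormal:
  assumes "n \<ge> 1"
  shows "(\<Sum>x\<in>anti_gauss_nodes cheb_weight n.
      anti_gauss_weight cheb_weight n x * poly (orthonormal_op cheb_weight m) x) = rule_value 1 n m"
proof -
  have "(\<Sum>x\<in>anti_gauss_nodes cheb_weight n.
      anti_gauss_weight cheb_weight n x * poly (orthonormal_op cheb_weight m) x)
    = (\<Sum>k\<le>n. anti_gauss_weight cheb_weight n (cos (real k * pi / real n))
        * poly (orthonormal_op cheb_weight m) (cos (real k * pi / real n)))"
    by (rule sum.reindex_bij_betw[OF anti_gauss_nodes_cheb[OF assms], symmetric])
  also have "\<dots> = pi / real n / sqrt (if m = 0 then pi else pi / 2)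
      * (\<Sum>k\<le>n. trapezoid_weight n k * cos (real k * (real m * pi / real n)))"
    unfolding sum_distrib_left
  proof (rule sum.cong)
    fix k assume "k \<in> {..n}"
    then have weight: "anti_gauss_weight cheb_weight n (cos (real k * pi / real n))
        = pi / real n * trapezoid_weight n k"
      using assms by (intro anti_gauss_weight_cheb) auto
    have swap: "real m * (real k * pi / real n) = real k * (real m * pi / real n)"
      by simp
    show "anti_gauss_weight cheb_weight n (cos (real k * pi / real n))
          * poly (orthonormal_op cheb_weight m) (cos (real k * pi / real n))
        = pi / real n / sqrt (if m = 0 then pi else pi / 2)
          * (trapezoid_weight n k * cos (real k * (real m * pi / real n)))"
      unfolding weight orthonormal_op_cheb poly_smult poly_cheb_T_cos swap by simp
  qed simp
  also have "\<dots> = rule_value 1 n m"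
    unfolding cos_trapezoid_sum[OF assms]
    using rule_value_eq[OF assms, of m 1] by (simp only: power_one mult_1_right)
  finally show ?thesis .
qed

section \<open>Splitting a double series\<close>

lemma infsum_first_two:
  fixes h :: "nat \<Rightarrow> real"
  assumes "h summable_on UNIV"
  shows "infsum h UNIV = h 0 + h 1 + infsum h {2..}"
proof -
  have "h summable_on {2..}"
    using assms by (rule summable_on_subset_banach) simp
  moreover have "(UNIV :: nat set) = {0, 1} \<union> {2..}"
    by auto
  ultimately have "infsum h UNIV = infsum h {0, 1} + infsum h {2..}"
    using infsum_Un_disjoint[of h "{0, 1}" "{2..}"] by simp
  then show ?thesis
    by simp
qed

lemma double_infsum_first_two:
  fixes g :: "nat \<Rightarrow> nat \<Rightarrow> real"
  assumes "((\<lambda>(i, j). g i j) has_sum S) UNIV"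
  shows "S = g 0 0 + (g 1 0 + g 0 1) + g 1 1
    + (\<Sum>\<^sub>\<infinity>i\<in>{2..}. g i 0 + g i 1)
    + (\<Sum>\<^sub>\<infinity>i\<in>{2..}. \<Sum>\<^sub>\<infinity>j\<in>{2..}. g i j)
    + (\<Sum>\<^sub>\<infinity>j\<in>{2..}. g 0 j + g 1 j)"
proof -
  have summable: "(\<lambda>(i, j). g i j) summable_on UNIV \<times> UNIV"
    using assms by (auto simp: summable_on_def)
  have col: "(\<lambda>i. g i j) summable_on A" for A j
  proof -
    have "((\<lambda>(i, j). g i j) \<circ> (\<lambda>i. (i, j))) summable_on A"
      by (subst summable_on_reindex[symmetric])
         (auto intro: inj_onI summable_on_subset_banach[OF summable])
    then show ?thesis
      by (simp add: o_def)
  qed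
  have row: "(\<lambda>j. g i j) summable_on A" for A i
  proof -
    have "((\<lambda>(i, j). g i j) \<circ> Pair i) summable_on A"
      by (subst summable_on_reindex[symmetric])
         (auto intro: inj_onI summable_on_subset_banach[OF summable])
    then show ?thesis
      by (simp add: o_def)
  qed
  have rows: "(\<lambda>i. \<Sum>\<^sub>\<infinity>j. g i j) summable_on UNIV"
    using summable_on_Sigma_banach[of "\<lambda>i j. g i j" UNIV "\<lambda>_. UNIV"] summable by simp
  have tails: "(\<lambda>i. \<Sum>\<^sub>\<infinity>j\<in>{2..}. g i j) summable_on {2..}"
    using summable_on_Sigma_banach[of "\<lambda>i j. g i j" "{2..}" "\<lambda>_. {2..}"]
      summable_on_subset_banach[OF summable, of "{2..} \<times> {2..}"] by simp
  have "S = (\<Sum>\<^sub>\<infinity>(i, j)\<in>UNIV \<times> UNIV. g i j)"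
    using assms infsumI by fastforce
  also have "\<dots> = (\<Sum>\<^sub>\<infinity>i. \<Sum>\<^sub>\<infinity>j. g i j)"
    using infsum_Sigma'_banach[of "\<lambda>i j. g i j" UNIV "\<lambda>_. UNIV"] summable by simp
  also have "\<dots> = (\<Sum>\<^sub>\<infinity>j. g 0 j) + (\<Sum>\<^sub>\<infinity>j. g 1 j) + (\<Sum>\<^sub>\<infinity>i\<in>{2..}. \<Sum>\<^sub>\<infinity>j. g i j)"
    by (rule infsum_first_two[OF rows])
  also have "(\<Sum>\<^sub>\<infinity>i\<in>{2..}. \<Sum>\<^sub>\<infinity>j. g i j)
      = (\<Sum>\<^sub>\<infinity>i\<in>{2..}. (g i 0 + g i 1) + (\<Sum>\<^sub>\<infinity>j\<in>{2..}. g i j))"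
    by (simp only: infsum_first_two[OF row])
  also have "\<dots> = (\<Sum>\<^sub>\<infinity>i\<in>{2..}. g i 0 + g i 1) + (\<Sum>\<^sub>\<infinity>i\<in>{2..}. \<Sum>\<^sub>\<infinity>j\<in>{2..}. g i j)"
    by (intro infsum_add summable_on_add col tails)
  also have "(\<Sum>\<^sub>\<infinity>j. g 0 j) = g 0 0 + g 0 1 + (\<Sum>\<^sub>\<infinity>j\<in>{2..}. g 0 j)"
    by (rule infsum_first_two[OF row])
  also have "(\<Sum>\<^sub>\<infinity>j. g 1 j) = g 1 0 + g 1 1 + (\<Sum>\<^sub>\<infinity>j\<in>{2..}. g 1 j)"
    by (rule infsum_first_two[OF row])
  finally show ?thesis
    by (simp add: infsum_add[OF row row])
qed

section \<open>Errors of the product rules\<close>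

lemma has_sum_finite_sum:
  fixes g :: "'a \<Rightarrow> 'b \<Rightarrow> real"
  assumes "\<And>x. x \<in> X \<Longrightarrow> (g x has_sum S x) A"
  shows "((\<lambda>i. \<Sum>x\<in>X. g x i) has_sum (\<Sum>x\<in>X. S x)) A"
  using assms
  by (induction X rule: infinite_finite_induct) (auto intro: has_sum_add)

text \<open>
  A product rule uses finitely many function values, so it can be applied to the expansion term by
  term; on each basis function it factorizes.
\<close>
lemma product_rule_expansion:
  assumes conv: "\<And>x. x \<in> X \<times> Y \<Longrightarrow> expansion_converges_at f x"
  shows "((\<lambda>(i, j). expansion_coeff f i j
      * (\<Sum>x\<in>X. u x * poly (orthonormal_op cheb_weight i) x)
      * (\<Sum>y\<in>Y. v y * poly (orthonormal_op cheb_weight j) y))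
    has_sum (\<Sum>x\<in>X. \<Sum>y\<in>Y. u x * v y * f (x, y))) UNIV"
proof -
  have "((\<lambda>ij. \<Sum>x\<in>X. \<Sum>y\<in>Y. u x * v y *
        (case ij of (i, j) \<Rightarrow> expansion_coeff f i j * expansion_basis i j (x, y)))
      has_sum (\<Sum>x\<in>X. \<Sum>y\<in>Y. u x * v y * f (x, y))) UNIV"
  proof (intro has_sum_finite_sum has_sum_cmult_right)
    fix x y assume "x \<in> X" "y \<in> Y"
    then show "((\<lambda>ij. case ij of (i, j) \<Rightarrow> expansion_coeff f i j * expansion_basis i j (x, y))
        has_sum f (x, y)) UNIV"
      using conv unfolding expansion_converges_at_def by blast
  qed
  moreover have "(\<Sum>x\<in>X. \<Sum>y\<in>Y. u x * v y *
        (case ij of (i, j) \<Rightarrow> expansion_coeff f i j * expansion_basis i j (x, y)))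
      = (case ij of (i, j) \<Rightarrow> expansion_coeff f i j
      * (\<Sum>x\<in>X. u x * poly (orthonormal_op cheb_weight i) x)
      * (\<Sum>y\<in>Y. v y * poly (orthonormal_op cheb_weight j) y))" for ij
    by (cases ij) (simp add: expansion_basis_def sum_distrib_left sum_distrib_right mult_ac)
  ultimately show ?thesis
    by simp
qed

text \<open>
  The two error terms in a single formula: the sign \<open>s\<close> is \<open>- 1\<close> for the Gauss rules and \<open>1\<close> for
  the anti-Gauss rules. The inner factor \<open>s\<close> belongs to the terms with one index equal to \<open>1\<close>.
\<close>
definition rule_err :: "real \<Rightarrow> (real \<times> real \<Rightarrow> real) \<Rightarrow> nat \<Rightarrow> nat \<Rightarrow> real" where
  "rule_err s f n1 n2 = (let \<alpha> = (\<lambda>k1 k2. expansion_coeff f (2 * n1 * k1) (2 * n2 * k2)) in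
     sqrt 2 * \<alpha> 1 1
     + (\<Sum>\<^sub>\<infinity>k\<in>{2..}. s ^ k * (\<alpha> k 0 + s * (sqrt 2 * \<alpha> k 1)))
     + sqrt 2 * (\<Sum>\<^sub>\<infinity>k1\<in>{2..}. \<Sum>\<^sub>\<infinity>k2\<in>{2..}. s ^ (k1 + k2) * \<alpha> k1 k2)
     + (\<Sum>\<^sub>\<infinity>k\<in>{2..}. s ^ k * (\<alpha> 0 k + s * (sqrt 2 * \<alpha> 1 k))))"

lemma rule_err_signs: "rule_err (- 1) f n1 n2 = err1 f n1 n2" "rule_err 1 f n1 n2 = err2 f n1 n2"
  by (simp_all add: rule_err_def err1_def err2_def Let_def)

lemma cheb_integral_eq: "cheb_integral f = pi * expansion_coeff f 0 0"
proof -
  have "expansion_basis 0 0 x = 1 / pi" for x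
    by (simp add: expansion_basis_def orthonormal_op_cheb)
  then have "expansion_coeff f 0 0 = (LINT x:square|lebesgue. 1 / pi * (f x * cheb_weight2 x))"
    by (simp add: expansion_coeff_def mult_ac)
  also have "\<dots> = 1 / pi * cheb_integral f"
    unfolding cheb_integral_def by (rule set_integral_mult_right)
  finally show ?thesis
    by simp
qed

text \<open>
  Only coefficients with indices \<open>2 n\<^sub>1 k\<^sub>1\<close> and \<open>2 n\<^sub>2 k\<^sub>2\<close> survive. Relative to the common
  factor \<open>\<surd>2 \<pi>\<close>, the terms with one index \<open>0\<close> have weight \<open>1\<close> and those with none have weight
  \<open>\<surd>2\<close>, because \<open>p\<^sub>0\<close> is normalized differently from the other orthonormal polynomials. The
  term with both indices \<open>0\<close> is the integral.
\<close>
lemma rule_error: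
  assumes n: "n1 \<ge> 1" "n2 \<ge> 1" and s: "s\<^sup>2 = 1"
    and S: "((\<lambda>(i, j). expansion_coeff f i j * rule_value s n1 i * rule_value s n2 j) has_sum S) UNIV"
  shows "S - cheb_integral f = sqrt 2 * pi *
    (s * (expansion_coeff f (2 * n1) 0 + expansion_coeff f 0 (2 * n2)) + rule_err s f n1 n2)"
proof -
  define \<alpha> where "\<alpha> k1 k2 = expansion_coeff f (2 * n1 * k1) (2 * n2 * k2)" for k1 k2
  define h where "h = (\<lambda>(k1, k2). (2 * n1 * k1, 2 * n2 * k2))"
  define r where "r k = (if k = 0 then sqrt pi else sqrt (2 * pi) * s ^ k)" for k :: nat
  have r: "rule_value s n (2 * n * k) = r k" if "n \<ge> 1" for n k
    using that by (simp add: rule_value_def r_def)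
  have "inj h"
    using n by (auto simp: h_def inj_def)
  let ?F = "\<lambda>(i, j). expansion_coeff f i j * rule_value s n1 i * rule_value s n2 j"
  have "(?F has_sum S) UNIV \<longleftrightarrow> (?F has_sum S) (range h)"
  proof (rule has_sum_cong_neutral)
    fix x assume x: "x \<in> UNIV - range h"
    obtain i j where ij: "x = (i, j)"
      by (cases x)
    have "\<not> (2 * n1 dvd i \<and> 2 * n2 dvd j)"
    proof
      assume "2 * n1 dvd i \<and> 2 * n2 dvd j"
      then obtain k1 k2 where "i = 2 * n1 * k1" "j = 2 * n2 * k2"
        by (auto elim!: dvdE)
      then have "x = h (k1, k2)"
        by (simp add: h_def ij)
      with x show False
        by blast
    qed
    then show "?F x = 0"
      by (auto simp: ij rule_value_def)
  qed auto
  then have "((?F \<circ> h) has_sum S) UNIV"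
    using S has_sum_reindex[OF \<open>inj h\<close>] by blast
  moreover have "?F \<circ> h = (\<lambda>(k1, k2). \<alpha> k1 k2 * r k1 * r k2)"
    using n by (auto simp: h_def \<alpha>_def r fun_eq_iff)
  ultimately have sum: "((\<lambda>(k1, k2). \<alpha> k1 k2 * r k1 * r k2) has_sum S) UNIV"
    by simp
  define g where "g k1 k2 = \<alpha> k1 k2 * r k1 * r k2" for k1 k2
  have r0: "r 0 * r 0 = pi"
    by (simp add: r_def)
  have r1: "r 0 * r k = sqrt 2 * pi * s ^ k" "r k * r 0 = sqrt 2 * pi * s ^ k" if "k \<noteq> 0" for k
    using that by (simp_all add: r_def real_sqrt_mult)
  have r2: "r j * r k = sqrt 2 * pi * (sqrt 2 * s ^ (j + k))" if "j \<noteq> 0" "k \<noteq> 0" for j k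
    using that by (simp add: r_def real_sqrt_mult power_add)
  have g00: "g 0 0 = pi * \<alpha> 0 0"
    using r0 by (simp add: g_def mult.assoc)
  have g1: "g k 0 = sqrt 2 * pi * (s ^ k * \<alpha> k 0)" "g 0 k = sqrt 2 * pi * (s ^ k * \<alpha> 0 k)"
    if "k \<noteq> 0" for k
    using r1[OF that] by (simp_all add: g_def mult.assoc)
  have g2: "g j k = sqrt 2 * pi * (sqrt 2 * (s ^ (j + k) * \<alpha> j k))" if "j \<noteq> 0" "k \<noteq> 0" for j k
    using r2[OF that] by (simp add: g_def mult.assoc)
  have "S = g 0 0 + (g 1 0 + g 0 1) + g 1 1
    + (\<Sum>\<^sub>\<infinity>i\<in>{2..}. g i 0 + g i 1)
    + (\<Sum>\<^sub>\<infinity>i\<in>{2..}. \<Sum>\<^sub>\<infinity>j\<in>{2..}. g i j)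
    + (\<Sum>\<^sub>\<infinity>j\<in>{2..}. g 0 j + g 1 j)"
    using sum unfolding g_def by (rule double_infsum_first_two)
  moreover have "(\<Sum>\<^sub>\<infinity>i\<in>{2..}. g i 0 + g i 1)
      = sqrt 2 * pi * (\<Sum>\<^sub>\<infinity>k\<in>{2..}. s ^ k * (\<alpha> k 0 + s * (sqrt 2 * \<alpha> k 1)))"
    unfolding infsum_cmult_right'[symmetric]
    by (rule infsum_cong) (simp add: g1 g2 algebra_simps)
  moreover have "(\<Sum>\<^sub>\<infinity>j\<in>{2..}. g 0 j + g 1 j)
      = sqrt 2 * pi * (\<Sum>\<^sub>\<infinity>k\<in>{2..}. s ^ k * (\<alpha> 0 k + s * (sqrt 2 * \<alpha> 1 k)))"
    unfolding infsum_cmult_right'[symmetric]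
    by (rule infsum_cong) (simp add: g1 g2 algebra_simps)
  moreover have "(\<Sum>\<^sub>\<infinity>i\<in>{2..}. \<Sum>\<^sub>\<infinity>j\<in>{2..}. g i j)
      = sqrt 2 * pi * (sqrt 2 * (\<Sum>\<^sub>\<infinity>k1\<in>{2..}. \<Sum>\<^sub>\<infinity>k2\<in>{2..}. s ^ (k1 + k2) * \<alpha> k1 k2))"
    unfolding infsum_cmult_right'[symmetric]
    by (intro infsum_cong) (simp add: g2)
  moreover have "g 1 0 + g 0 1 = sqrt 2 * pi * (s * (\<alpha> 1 0 + \<alpha> 0 1))"
    by (simp add: g1 algebra_simps)
  moreover have "g 1 1 = sqrt 2 * pi * (sqrt 2 * \<alpha> 1 1)"
    using s by (simp add: g2 power2_eq_square)
  ultimately have "S = pi * \<alpha> 0 0 + sqrt 2 * pi * (s * (\<alpha> 1 0 + \<alpha> 0 1) + rule_err s f n1 n2)"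
    unfolding rule_err_def Let_def \<alpha>_def[symmetric] g00 by (simp only: distrib_left add_ac)
  then show ?thesis
    by (simp add: cheb_integral_eq \<alpha>_def)
qed

theorem corollary2p3:
  fixes f :: "real \<times> real \<Rightarrow> real" and n1 n2 :: nat
  assumes n: "n1 \<ge> 1" "n2 \<ge> 1"
    and integrable: "set_integrable lebesgue square (\<lambda>x. f x * cheb_weight2 x)"
    and conv_gauss: "\<forall>x \<in> gauss_nodes cheb_weight n1 \<times> gauss_nodes cheb_weight n2.
      expansion_converges_at f x"
    and conv_anti_gauss: "\<forall>x \<in> anti_gauss_nodes cheb_weight n1 \<times> anti_gauss_nodes cheb_weight n2.
      expansion_converges_at f x"
    and small: "max \<bar>err1 f n1 n2\<bar> \<bar>err2 f n1 n2\<bar>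
      < \<bar>expansion_coeff f (2 * n1) 0 + expansion_coeff f 0 (2 * n2)\<bar>"
  shows "(gauss_cubature cheb_weight n1 n2 f \<le> cheb_integral f \<and>
          cheb_integral f \<le> anti_gauss_cubature cheb_weight n1 n2 f) \<or>
         (anti_gauss_cubature cheb_weight n1 n2 f \<le> cheb_integral f \<and>
          cheb_integral f \<le> gauss_cubature cheb_weight n1 n2 f)"
proof -
  define a where "a = expansion_coeff f (2 * n1) 0 + expansion_coeff f 0 (2 * n2)"
  have "((\<lambda>(i, j). expansion_coeff f i j * rule_value (- 1) n1 i * rule_value (- 1) n2 j)
      has_sum gauss_cubature cheb_weight n1 n2 f) UNIV"
    using product_rule_expansion[of "gauss_nodes cheb_weight n1" "gauss_nodes cheb_weight n2" f
        "christoffel_number cheb_weight n1" "christoffel_number cheb_weight n2"] conv_gauss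
    by (simp add: gauss_rule_orthonormal[OF n(1)] gauss_rule_orthonormal[OF n(2)] gauss_cubature_def)
  then have gauss: "gauss_cubature cheb_weight n1 n2 f - cheb_integral f
      = sqrt 2 * pi * (err1 f n1 n2 - a)"
    using rule_error[OF n, of "- 1"] by (simp add: rule_err_signs a_def)
  have "((\<lambda>(i, j). expansion_coeff f i j * rule_value 1 n1 i * rule_value 1 n2 j)
      has_sum anti_gauss_cubature cheb_weight n1 n2 f) UNIV"
    using product_rule_expansion[of "anti_gauss_nodes cheb_weight n1" "anti_gauss_nodes cheb_weight n2" f
        "anti_gauss_weight cheb_weight n1" "anti_gauss_weight cheb_weight n2"] conv_anti_gauss
    by (simp add: anti_gauss_rule_orthonormal[OF n(1)] anti_gauss_rule_orthonormal[OF n(2)]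
        anti_gauss_cubature_def)
  then have anti_gauss: "anti_gauss_cubature cheb_weight n1 n2 f - cheb_integral f
      = sqrt 2 * pi * (a + err2 f n1 n2)"
    using rule_error[OF n, of 1] by (simp add: rule_err_signs a_def)
  have sign: "x \<le> y \<longleftrightarrow> c \<le> 0" "y \<le> x \<longleftrightarrow> 0 \<le> c" if "x - y = sqrt 2 * pi * c" for x y c :: real
  proof -
    have "\<not> pi \<le> 0"
      using pi_gt_zero by linarith
    then show "x \<le> y \<longleftrightarrow> c \<le> 0" "y \<le> x \<longleftrightarrow> 0 \<le> c"
      using that by (simp_all add: mult_le_0_iff zero_le_mult_iff
        flip: diff_le_0_iff_le[of x] diff_ge_0_iff_ge[of x])
  qed
  have "\<bar>err1 f n1 n2\<bar> < \<bar>a\<bar>" "\<bar>err2 f n1 n2\<bar> < \<bar>a\<bar>"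
    using small by (simp_all add: a_def)
  then show ?thesis
    unfolding sign[OF gauss] sign[OF anti_gauss] by linarith
qed

end
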